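(* Let $(\mathcal{M},g)$ be a smooth Riemannian manifold with Levi-Civita connection $D$ and curvature tensor $R$, and let $\varepsilon$ be a random function on $\mathcal{M}$ that is almost surely $C^2$. Put $\widetilde X=\varepsilon X$ for every smooth vector field $X$, and define the stochastic curvature tensor $$\widetilde R(X,Y)Z:=D_{\widetilde X}D_{\widetilde Y}\widetilde Z-D_{\widetilde Y}D_{\widetilde X}\widetilde Z-D_{[\widetilde X,\widetilde Y]}\widetilde Z.$$ Then, almost surely, for all smooth vector fields $X,Y,Z$ on $\mathcal{M}$, $$\widetilde R(X,Y)Z=\varepsilon^3R(X,Y)Z.$$
   Context: The curvature tensor of $D$ is $R(X,Y)Z=D_XD_YZ-D_YD_XZ-D_{[X,Y]}Z$. *)

theory Defs
  imports "HOL-Probability.Probability" "HOL-Library.Function_Algebras"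
begin

section \<open>Functions of class \<open>C\<^sup>k\<close> on open subsets of a Euclidean space\<close>

primrec nCk_on :: "nat \<Rightarrow> ('b::euclidean_space \<Rightarrow> 'c::real_normed_vector) \<Rightarrow> 'b set \<Rightarrow> bool" where
  "nCk_on 0 f S \<longleftrightarrow> continuous_on S f"
| "nCk_on (Suc n) f S \<longleftrightarrow>
     (\<forall>x\<in>S. f differentiable (at x)) \<and> (\<forall>v. nCk_on n (\<lambda>x. frechet_derivative f (at x) v) S)"

definition Ck_on :: "enat \<Rightarrow> ('b::euclidean_space \<Rightarrow> 'c::real_normed_vector) \<Rightarrow> 'b set \<Rightarrow> bool" where
  "Ck_on k f S \<longleftrightarrow> (\<forall>n. enat n \<le> k \<longrightarrow> nCk_on n f S)"

section \<open>Smooth manifolds\<close>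

text \<open>The underlying topological space is the whole type \<open>'m\<close>; Hausdorff and second countable
  are imposed by sort constraints where a manifold is fixed. A chart is a pair \<open>(U, \<phi>)\<close>, and only
  the values of \<open>\<phi>\<close> on \<open>U\<close> matter.\<close>

type_synonym ('m, 'b) chart = "'m set \<times> ('m \<Rightarrow> 'b)"

abbreviation chart_inv :: "('m, 'b) chart \<Rightarrow> 'b \<Rightarrow> 'm" where
  "chart_inv c \<equiv> inv_into (fst c) (snd c)"

abbreviation chart_img :: "('m, 'b) chart \<Rightarrow> 'b set" where
  "chart_img c \<equiv> snd c ` fst c"

definition is_chart :: "('m::topological_space, 'b::euclidean_space) chart \<Rightarrow> bool" where
  "is_chart c \<longleftrightarrow> open (fst c) \<and> open (chart_img c) \<and>
     homeomorphism (fst c) (chart_img c) (snd c) (chart_inv c)"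

definition transition :: "('m, 'b) chart \<Rightarrow> ('m, 'b) chart \<Rightarrow> 'b \<Rightarrow> 'b" where
  "transition c d = (\<lambda>x. snd d (chart_inv c x))"

definition smooth_atlas :: "('m::topological_space, 'b::euclidean_space) chart set \<Rightarrow> bool" where
  "smooth_atlas A \<longleftrightarrow>
     (\<forall>c\<in>A. is_chart c) \<and> (\<Union>c\<in>A. fst c) = UNIV \<and>
     (\<forall>c\<in>A. \<forall>d\<in>A. Ck_on \<infinity> (transition c d) (snd c ` (fst c \<inter> fst d)))"

definition Ck_fun :: "('m, 'b::euclidean_space) chart set \<Rightarrow> enat \<Rightarrow> ('m \<Rightarrow> real) \<Rightarrow> bool" where
  "Ck_fun A k f \<longleftrightarrow> (\<forall>c\<in>A. Ck_on k (\<lambda>x. f (chart_inv c x)) (chart_img c))"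

section \<open>Tangent vectors and vector fields\<close>

text \<open>A tangent vector at \<open>p\<close> is the family of its components in all charts around \<open>p\<close>, related
  to one another by the differentials of the transition maps; equivalently, it is the graph of an
  equivalence class of pairs (chart, component vector). The components in the other charts are set
  to 0, so that equality of tangent vectors is equality of functions and the vector space
  operations are pointwise.\<close>

type_synonym ('m, 'b) tvec = "('m, 'b) chart \<Rightarrow> 'b"

type_synonym ('m, 'b) vfield = "'m \<Rightarrow> ('m, 'b) tvec"

definition tangent_space ::
    "('m, 'b::euclidean_space) chart set \<Rightarrow> 'm \<Rightarrow> ('m, 'b) tvec set" where
  "tangent_space A p = {v.
     (\<forall>c. \<not> (c \<in> A \<and> p \<in> fst c) \<longrightarrow> v c = 0) \<and>
     (\<forall>c\<in>A. \<forall>d\<in>A. p \<in> fst c \<inter> fst d \<longrightarrow>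
        v d = frechet_derivative (transition c d) (at (snd c p)) (v c))}"

definition local_rep :: "('m, 'b) vfield \<Rightarrow> ('m, 'b) chart \<Rightarrow> 'b \<Rightarrow> 'b" where
  "local_rep X c = (\<lambda>x. X (chart_inv c x) c)"

definition Ck_vfield ::
    "('m, 'b::euclidean_space) chart set \<Rightarrow> enat \<Rightarrow> ('m, 'b) vfield \<Rightarrow> bool" where
  "Ck_vfield A k X \<longleftrightarrow>
     (\<forall>p. X p \<in> tangent_space A p) \<and> (\<forall>c\<in>A. Ck_on k (local_rep X c) (chart_img c))"

definition tscale :: "real \<Rightarrow> ('m, 'b::euclidean_space) tvec \<Rightarrow> ('m, 'b) tvec" where
  "tscale a v = (\<lambda>c. a *\<^sub>R v c)"

definition fscale ::
    "('m \<Rightarrow> real) \<Rightarrow> ('m, 'b::euclidean_space) vfield \<Rightarrow> ('m, 'b) vfield" where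
  "fscale f X = (\<lambda>p. tscale (f p) (X p))"

text \<open>The derivative \<open>X f\<close>. By the chain rule it does not depend on the selected chart.\<close>

definition vderiv ::
    "('m, 'b::euclidean_space) chart set \<Rightarrow> ('m, 'b) vfield \<Rightarrow> ('m \<Rightarrow> real) \<Rightarrow> 'm \<Rightarrow> real" where
  "vderiv A X f = (\<lambda>p. let c = (SOME c. c \<in> A \<and> p \<in> fst c) in
     frechet_derivative (\<lambda>x. f (chart_inv c x)) (at (snd c p)) (X p c))"

text \<open>The Lie bracket in local coordinates,
  \<open>[X,Y]\<^sup>i = X\<^sup>j \<partial>\<^sub>j Y\<^sup>i - Y\<^sup>j \<partial>\<^sub>j X\<^sup>i\<close>, which makes sense for fields of class \<open>C\<^sup>1\<close>.\<close>

definition lie_bracket ::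
    "('m, 'b::euclidean_space) chart set \<Rightarrow> ('m, 'b) vfield \<Rightarrow> ('m, 'b) vfield \<Rightarrow> ('m, 'b) vfield"
where
  "lie_bracket A X Y = (\<lambda>p c.
     if c \<in> A \<and> p \<in> fst c
     then frechet_derivative (local_rep Y c) (at (snd c p)) (X p c) -
          frechet_derivative (local_rep X c) (at (snd c p)) (Y p c)
     else 0)"

section \<open>Riemannian metrics, the Levi-Civita connection and curvature\<close>

definition riemannian_metric ::
    "('m, 'b::euclidean_space) chart set \<Rightarrow> ('m \<Rightarrow> ('m, 'b) tvec \<Rightarrow> ('m, 'b) tvec \<Rightarrow> real) \<Rightarrow> bool"
where
  "riemannian_metric A g \<longleftrightarrow>
     (\<forall>p. \<forall>u\<in>tangent_space A p. \<forall>v\<in>tangent_space A p. \<forall>w\<in>tangent_space A p. \<forall>a b.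
        g p (tscale a u + tscale b v) w = a * g p u w + b * g p v w) \<and>
     (\<forall>p. \<forall>u\<in>tangent_space A p. \<forall>v\<in>tangent_space A p. g p u v = g p v u) \<and>
     (\<forall>p. \<forall>v\<in>tangent_space A p. v \<noteq> 0 \<longrightarrow> g p v v > 0) \<and>
     (\<forall>X Y. Ck_vfield A \<infinity> X \<longrightarrow> Ck_vfield A \<infinity> Y \<longrightarrow> Ck_fun A \<infinity> (\<lambda>p. g p (X p) (Y p)))"

definition riemannian_manifold ::
    "('m::topological_space, 'b::euclidean_space) chart set \<Rightarrow>
      ('m \<Rightarrow> ('m, 'b) tvec \<Rightarrow> ('m, 'b) tvec \<Rightarrow> real) \<Rightarrow> bool"
where
  "riemannian_manifold A g \<longleftrightarrow> smooth_atlas A \<and> riemannian_metric A g"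

text \<open>An affine connection, acting on fields of finite differentiability class as well:
  \<open>D X Y\<close> is meaningful for \<open>X\<close> of class \<open>C\<^sup>0\<close> and \<open>Y\<close> of class \<open>C\<^sup>1\<close>. This is the usual extension
  of a connection on smooth fields (in coordinates, \<open>Y \<mapsto> X\<^sup>j (\<partial>\<^sub>j Y\<^sup>i + \<Gamma>\<^sup>i\<^sub>j\<^sub>k Y\<^sup>k)\<close>), and it is
  determined by the restriction to smooth fields: expand \<open>X\<close> and \<open>Y\<close> in a smooth local frame.
  The case \<open>k = \<infinity>\<close> of the first conjunct says that \<open>D\<close> maps smooth fields to smooth fields.\<close>

definition affine_connection ::
    "('m, 'b::euclidean_space) chart set \<Rightarrow>
      (('m, 'b) vfield \<Rightarrow> ('m, 'b) vfield \<Rightarrow> ('m, 'b) vfield) \<Rightarrow> bool"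
where
  "affine_connection A D \<longleftrightarrow>
     (\<forall>k X Y. Ck_vfield A k X \<longrightarrow> Ck_vfield A (k + 1) Y \<longrightarrow> Ck_vfield A k (D X Y)) \<and>
     (\<forall>X X' Y. Ck_vfield A 0 X \<longrightarrow> Ck_vfield A 0 X' \<longrightarrow> Ck_vfield A 1 Y \<longrightarrow>
        D (X + X') Y = D X Y + D X' Y) \<and>
     (\<forall>f X Y. Ck_fun A 0 f \<longrightarrow> Ck_vfield A 0 X \<longrightarrow> Ck_vfield A 1 Y \<longrightarrow>
        D (fscale f X) Y = fscale f (D X Y)) \<and>
     (\<forall>X Y Y'. Ck_vfield A 0 X \<longrightarrow> Ck_vfield A 1 Y \<longrightarrow> Ck_vfield A 1 Y' \<longrightarrow>
        D X (Y + Y') = D X Y + D X Y') \<and>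
     (\<forall>f X Y. Ck_fun A 1 f \<longrightarrow> Ck_vfield A 0 X \<longrightarrow> Ck_vfield A 1 Y \<longrightarrow>
        D X (fscale f Y) = fscale (vderiv A X f) Y + fscale f (D X Y))"

definition torsion_free ::
    "('m, 'b::euclidean_space) chart set \<Rightarrow>
      (('m, 'b) vfield \<Rightarrow> ('m, 'b) vfield \<Rightarrow> ('m, 'b) vfield) \<Rightarrow> bool"
where
  "torsion_free A D \<longleftrightarrow>
     (\<forall>X Y. Ck_vfield A \<infinity> X \<longrightarrow> Ck_vfield A \<infinity> Y \<longrightarrow> D X Y - D Y X = lie_bracket A X Y)"

definition metric_compatible ::
    "('m, 'b::euclidean_space) chart set \<Rightarrow> ('m \<Rightarrow> ('m, 'b) tvec \<Rightarrow> ('m, 'b) tvec \<Rightarrow> real) \<Rightarrow>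
      (('m, 'b) vfield \<Rightarrow> ('m, 'b) vfield \<Rightarrow> ('m, 'b) vfield) \<Rightarrow> bool"
where
  "metric_compatible A g D \<longleftrightarrow>
     (\<forall>X Y Z. Ck_vfield A \<infinity> X \<longrightarrow> Ck_vfield A \<infinity> Y \<longrightarrow> Ck_vfield A \<infinity> Z \<longrightarrow>
        (\<forall>p. vderiv A X (\<lambda>q. g q (Y q) (Z q)) p = g p (D X Y p) (Z p) + g p (Y p) (D X Z p)))"

definition levi_civita ::
    "('m, 'b::euclidean_space) chart set \<Rightarrow> ('m \<Rightarrow> ('m, 'b) tvec \<Rightarrow> ('m, 'b) tvec \<Rightarrow> real) \<Rightarrow>
      (('m, 'b) vfield \<Rightarrow> ('m, 'b) vfield \<Rightarrow> ('m, 'b) vfield) \<Rightarrow> bool"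
where
  "levi_civita A g D \<longleftrightarrow> affine_connection A D \<and> torsion_free A D \<and> metric_compatible A g D"

definition curvature ::
    "('m, 'b::euclidean_space) chart set \<Rightarrow>
      (('m, 'b) vfield \<Rightarrow> ('m, 'b) vfield \<Rightarrow> ('m, 'b) vfield) \<Rightarrow>
      ('m, 'b) vfield \<Rightarrow> ('m, 'b) vfield \<Rightarrow> ('m, 'b) vfield \<Rightarrow> ('m, 'b) vfield"
where
  "curvature A D X Y Z = D X (D Y Z) - D Y (D X Z) - D (lie_bracket A X Y) Z"

text \<open>For one realisation \<open>e\<close> of the random function.\<close>

definition stochastic_curvature ::
    "('m, 'b::euclidean_space) chart set \<Rightarrow>
      (('m, 'b) vfield \<Rightarrow> ('m, 'b) vfield \<Rightarrow> ('m, 'b) vfield) \<Rightarrow> ('m \<Rightarrow> real) \<Rightarrow>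
      ('m, 'b) vfield \<Rightarrow> ('m, 'b) vfield \<Rightarrow> ('m, 'b) vfield \<Rightarrow> ('m, 'b) vfield"
where
  "stochastic_curvature A D e X Y Z =
     (let X' = fscale e X; Y' = fscale e Y; Z' = fscale e Z in
      D X' (D Y' Z') - D Y' (D X' Z') - D (lie_bracket A X' Y') Z')"

end

theory Submission
  imports Defs
begin

text \<open>
  Fix a realisation \<open>f\<close> of class \<open>C\<^sup>2\<close>. The curvature is tensorial, so rescaling its three arguments by
  \<open>f\<close> multiplies it by \<open>f\<^sup>3\<close>. As \<open>f\<close> is only of class \<open>C\<^sup>2\<close>, the usual computation is carried out for
  fields of finite class, with these three expansions:

    \<open>D\<^bsub>f X\<^esub> D\<^bsub>f Y\<^esub> (f Z) = f (f X(Y f) + (X f)(Y f)) Z + f\<^sup>2 (Y f) D\<^sub>X Z + 2 f\<^sup>2 (X f) D\<^sub>Y Z + f\<^sup>3 D\<^sub>X D\<^sub>Y Z\<close>,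

    \<open>[f X, f Y] = f\<^sup>2 [X, Y] + f (X f) Y - f (Y f) X\<close>,

    \<open>D\<^bsub>[f X, f Y]\<^esub> (f Z) = f\<^sup>2 (X(Y f) - Y(X f)) Z + f\<^sup>2 (X f) D\<^sub>Y Z - f\<^sup>2 (Y f) D\<^sub>X Z + f\<^sup>3 D\<^bsub>[X, Y]\<^esub> Z\<close>.

  Antisymmetrise the first in \<open>X, Y\<close> and subtract the third: every term that contains a derivative
  of \<open>f\<close> cancels (\<open>stochastic_curvature_eq\<close>).

  The analytic content lies in the identity \<open>[X, Y] f = X (Y f) - Y (X f)\<close> behind the third
  expansion (\<open>vderiv_lie_bracket\<close>). In a chart it is the symmetry of the second derivatives of a \<open>C\<^sup>2\<close>
  function (\<open>second_derivative_symmetric\<close>). On the manifold it also needs that the derivative along a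
  tangent vector is the same in every chart (\<open>vderiv_in_chart\<close>), and that \<open>[X, Y]\<close> consists of tangent
  vectors. The last point is read off from \<open>[X, Y] = D\<^sub>X Y - D\<^sub>Y X\<close>.
\<close>

section \<open>Calculus of functions of class \<open>C\<^sup>k\<close>\<close>

lemma frechet_derivative_eqI:
  "(f has_derivative f') (at x) \<Longrightarrow> frechet_derivative f (at x) = f'"
  by (rule frechet_derivative_at[symmetric])

text \<open>Off \<open>S\<close> the two functions may differ; openness makes their derivatives on \<open>S\<close> agree. In
  particular the derivative formulas below, which hold only on \<open>S\<close>, can be used under the
  recursion that defines the class.\<close>

lemma nCk_on_cong:
  assumes "open S" "\<And>x. x \<in> S \<Longrightarrow> f x = g x" "nCk_on n f S"
  shows "nCk_on n g S"
  using assms(2,3)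
proof (induction n arbitrary: f g)
  case 0
  then show ?case by (simp cong: continuous_on_cong)
next
  case (Suc n)
  have d: "(g has_derivative frechet_derivative f (at x)) (at x)" if "x \<in> S" for x
  proof (rule has_derivative_transform_within_open[OF _ assms(1) that Suc.prems(1)])
    show "(f has_derivative frechet_derivative f (at x)) (at x)"
      using Suc.prems(2) that by (simp flip: frechet_derivative_works)
  qed
  then have "\<And>x v. x \<in> S \<Longrightarrow> frechet_derivative f (at x) v = frechet_derivative g (at x) v"
    by (simp add: frechet_derivative_at[OF d])
  then have "nCk_on n (\<lambda>x. frechet_derivative g (at x) v) S" for v
    using Suc.IH[of "\<lambda>x. frechet_derivative f (at x) v" "\<lambda>x. frechet_derivative g (at x) v"]
      Suc.prems(2) by simp
  then show ?case using d by (auto simp: differentiable_def)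
qed

lemma nCk_on_SucD: "nCk_on (Suc n) f S \<Longrightarrow> nCk_on n f S"
proof (induction n arbitrary: f)
  case 0
  then show ?case
    by (auto intro!: continuous_at_imp_continuous_on dest: differentiable_imp_continuous_within)
qed simp_all

lemma nCk_on_const: "nCk_on n (\<lambda>x. c) S"
  by (induction n arbitrary: c) simp_all

lemma nCk_on_add:
  assumes "open S" "nCk_on n f S" "nCk_on n g S"
  shows "nCk_on n (\<lambda>x. f x + g x) S"
  using assms(2,3)
proof (induction n arbitrary: f g)
  case 0
  then show ?case by (simp add: continuous_on_add)
next
  case (Suc n)
  have d: "((\<lambda>x. f x + g x) has_derivative
      (\<lambda>v. frechet_derivative f (at x) v + frechet_derivative g (at x) v)) (at x)" if "x \<in> S" for x
    using Suc.prems that by (auto intro: has_derivative_add simp: frechet_derivative_works)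
  have "nCk_on n (\<lambda>x. frechet_derivative (\<lambda>x. f x + g x) (at x) v) S" for v
    by (rule nCk_on_cong[OF assms(1) _ Suc.IH[of "\<lambda>x. frechet_derivative f (at x) v"
            "\<lambda>x. frechet_derivative g (at x) v"]])
      (use Suc.prems in \<open>auto simp: frechet_derivative_eqI[OF d]\<close>)
  then show ?case using d by (auto simp: differentiable_def)
qed

lemma nCk_on_sum:
  assumes "open S" "finite I" "\<And>i. i \<in> I \<Longrightarrow> nCk_on n (f i) S"
  shows "nCk_on n (\<lambda>x. \<Sum>i\<in>I. f i x) S"
  using assms(2,3) by (induction I rule: finite_induct) (simp_all add: nCk_on_const nCk_on_add assms(1))

lemma nCk_on_scaleR:
  fixes f :: "'b::euclidean_space \<Rightarrow> real"
  assumes "open S" "nCk_on n f S" "nCk_on n g S"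
  shows "nCk_on n (\<lambda>x. f x *\<^sub>R g x) S"
  using assms(2,3)
proof (induction n arbitrary: f g)
  case 0
  then show ?case by (simp add: continuous_on_scaleR)
next
  case (Suc n)
  have d: "((\<lambda>x. f x *\<^sub>R g x) has_derivative
      (\<lambda>v. f x *\<^sub>R frechet_derivative g (at x) v + frechet_derivative f (at x) v *\<^sub>R g x)) (at x)"
    if "x \<in> S" for x
    using Suc.prems that by (auto intro: has_derivative_scaleR simp: frechet_derivative_works)
  have "nCk_on n (\<lambda>x. frechet_derivative (\<lambda>x. f x *\<^sub>R g x) (at x) v) S" for v
  proof (rule nCk_on_cong[OF assms(1)])
    show "nCk_on n (\<lambda>x. f x *\<^sub>R frechet_derivative g (at x) v + frechet_derivative f (at x) v *\<^sub>R g x) S"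
      using Suc.prems nCk_on_SucD[OF Suc.prems(1)] nCk_on_SucD[OF Suc.prems(2)]
      by (intro nCk_on_add assms(1) Suc.IH) simp_all
  qed (simp add: frechet_derivative_eqI[OF d])
  then show ?case using d by (auto simp: differentiable_def)
qed

lemma nCk_on_inner_left:
  assumes "open S" "nCk_on n f S"
  shows "nCk_on n (\<lambda>x. f x \<bullet> b) S"
  using assms(2)
proof (induction n arbitrary: f)
  case 0
  then show ?case by (simp add: continuous_on_inner)
next
  case (Suc n)
  have d: "((\<lambda>x. f x \<bullet> b) has_derivative (\<lambda>v. frechet_derivative f (at x) v \<bullet> b)) (at x)"
    if "x \<in> S" for x
    using Suc.prems that by (auto intro: has_derivative_inner_left simp: frechet_derivative_works)
  have "nCk_on n (\<lambda>x. frechet_derivative (\<lambda>x. f x \<bullet> b) (at x) v) S" for v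
    by (rule nCk_on_cong[OF assms(1) _ Suc.IH[of "\<lambda>x. frechet_derivative f (at x) v"]])
      (use Suc.prems in \<open>auto simp: frechet_derivative_eqI[OF d]\<close>)
  then show ?case using d by (auto simp: differentiable_def)
qed

lemma linear_eq_sum_Basis:
  fixes L :: "'b::euclidean_space \<Rightarrow> 'c::real_vector"
  assumes "linear L"
  shows "L v = (\<Sum>b\<in>Basis. (v \<bullet> b) *\<^sub>R L b)"
proof -
  have "L v = L (\<Sum>b\<in>Basis. (v \<bullet> b) *\<^sub>R b)" by (simp add: euclidean_representation)
  then show ?thesis by (simp add: linear_sum[OF assms] linear_cmul[OF assms])
qed

lemma frechet_derivative_eq_sum_Basis:
  assumes "f differentiable (at x)"
  shows "frechet_derivative f (at x) v = (\<Sum>b\<in>Basis. (v \<bullet> b) *\<^sub>R frechet_derivative f (at x) b)"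
  by (rule linear_eq_sum_Basis[OF linear_frechet_derivative[OF assms]])

text \<open>In coordinates \<open>f'(x)(Y x) = \<Sum>\<^sub>b Y\<^sub>b(x) \<partial>\<^sub>b f(x)\<close>, a finite sum of products of functions of class
  \<open>C\<^sup>n\<close>.\<close>

lemma nCk_on_directional_derivative:
  assumes "open S" "nCk_on (Suc n) f S" "nCk_on n Y S"
  shows "nCk_on n (\<lambda>x. frechet_derivative f (at x) (Y x)) S"
proof (rule nCk_on_cong[OF assms(1)])
  show "nCk_on n (\<lambda>x. \<Sum>b\<in>Basis. (Y x \<bullet> b) *\<^sub>R frechet_derivative f (at x) b) S"
    using assms by (intro nCk_on_sum nCk_on_scaleR nCk_on_inner_left) auto
  show "(\<Sum>b\<in>Basis. (Y x \<bullet> b) *\<^sub>R frechet_derivative f (at x) b) = frechet_derivative f (at x) (Y x)"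
    if "x \<in> S" for x
    using assms(2) that frechet_derivative_eq_sum_Basis[of f x "Y x"] by simp
qed

section \<open>Symmetry of second derivatives\<close>

text \<open>The double difference of \<open>f\<close> over the parallelogram spanned by \<open>h v\<close> and \<open>h w\<close> is symmetric in
  \<open>v\<close> and \<open>w\<close>. The mean value theorem, used first along \<open>v\<close> and then along \<open>w\<close>, turns it into
  \<open>h\<^sup>2\<close> times a single value of \<open>\<partial>\<^sub>w \<partial>\<^sub>v f\<close>.\<close>

lemma second_difference_mean_value:
  fixes f :: "'b::euclidean_space \<Rightarrow> real"
  assumes "0 < h" "h * (norm v + norm w) < r"
    and f: "\<And>y. y \<in> ball x r \<Longrightarrow> f differentiable (at y)"
    and fv: "\<And>y. y \<in> ball x r \<Longrightarrow> (\<lambda>y. frechet_derivative f (at y) v) differentiable (at y)"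
  obtains z where "z \<in> ball x r"
    "f (x + h *\<^sub>R v + h *\<^sub>R w) - f (x + h *\<^sub>R v) - f (x + h *\<^sub>R w) + f x
      = h\<^sup>2 * frechet_derivative (\<lambda>y. frechet_derivative f (at y) v) (at z) w"
proof -
  let ?F = "\<lambda>y. frechet_derivative f (at y)"
  let ?G = "\<lambda>y. frechet_derivative (\<lambda>y. frechet_derivative f (at y) v) (at y)"
  have inball: "x + s *\<^sub>R v + t *\<^sub>R w \<in> ball x r" if "0 \<le> s" "s \<le> h" "0 \<le> t" "t \<le> h" for s t
  proof -
    have "norm (s *\<^sub>R v + t *\<^sub>R w) \<le> s * norm v + t * norm w"
      using norm_triangle_ineq[of "s *\<^sub>R v" "t *\<^sub>R w"] that by simp
    also have "\<dots> \<le> h * (norm v + norm w)"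
      using that by (simp add: distrib_left add_mono mult_right_mono)
    also have "norm (s *\<^sub>R v + t *\<^sub>R w) = dist x (x + s *\<^sub>R v + t *\<^sub>R w)"
      by (metis add.assoc add_diff_cancel_left' dist_commute dist_norm)
    finally show ?thesis using assms(2) by simp
  qed
  have lin: "linear (?F y)" "linear (?G y)" if "y \<in> ball x r" for y
    using f fv that by (auto intro: linear_frechet_derivative)
  have line: "((\<lambda>s. f (x + s *\<^sub>R v + t *\<^sub>R w)) has_derivative (\<lambda>a. a * ?F (x + s *\<^sub>R v + t *\<^sub>R w) v)) (at s)"
    if "0 \<le> s" "s \<le> h" "0 \<le> t" "t \<le> h" for s t
  proof -
    have 1: "((\<lambda>s. x + s *\<^sub>R v + t *\<^sub>R w) has_derivative (\<lambda>a. a *\<^sub>R v)) (at s)"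
      by (auto intro!: derivative_eq_intros)
    have 2: "(f has_derivative ?F (x + s *\<^sub>R v + t *\<^sub>R w)) (at (x + s *\<^sub>R v + t *\<^sub>R w))"
      using f[OF inball[OF that]] by (simp add: frechet_derivative_works)
    show ?thesis
      using diff_chain_at[OF 1 2] by (simp add: o_def linear_cmul[OF lin(1)[OF inball[OF that]]])
  qed
  have line': "((\<lambda>t. ?F (x + s *\<^sub>R v + t *\<^sub>R w) v) has_derivative (\<lambda>a. a * ?G (x + s *\<^sub>R v + t *\<^sub>R w) w)) (at t)"
    if "0 \<le> s" "s \<le> h" "0 \<le> t" "t \<le> h" for s t
  proof -
    have 1: "((\<lambda>t. x + s *\<^sub>R v + t *\<^sub>R w) has_derivative (\<lambda>a. a *\<^sub>R w)) (at t)"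
      by (auto intro!: derivative_eq_intros)
    have 2: "((\<lambda>y. ?F y v) has_derivative ?G (x + s *\<^sub>R v + t *\<^sub>R w)) (at (x + s *\<^sub>R v + t *\<^sub>R w))"
      using fv[OF inball[OF that]] by (simp add: frechet_derivative_works)
    show ?thesis
      using diff_chain_at[OF 1 2] by (simp add: o_def linear_cmul[OF lin(2)[OF inball[OF that]]])
  qed
  \<comment> \<open>The summand \<open>0 *\<^sub>R w\<close> lets the derivative rules above cover both terms.\<close>
  define p where "p s = f (x + s *\<^sub>R v + h *\<^sub>R w) - f (x + s *\<^sub>R v + 0 *\<^sub>R w)" for s
  have dp: "(p has_derivative (\<lambda>a. a * ?F (x + s *\<^sub>R v + h *\<^sub>R w) v - a * ?F (x + s *\<^sub>R v + 0 *\<^sub>R w) v)) (at s)"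
    if "0 \<le> s" "s \<le> h" for s
    unfolding p_def using that assms(1) by (intro has_derivative_diff line) auto
  obtain s where s: "s \<in> {0<..<h}"
    "p h - p 0 = (h - 0) * ?F (x + s *\<^sub>R v + h *\<^sub>R w) v - (h - 0) * ?F (x + s *\<^sub>R v + 0 *\<^sub>R w) v"
    using mvt_simple[OF assms(1), of p "\<lambda>s a. a * ?F (x + s *\<^sub>R v + h *\<^sub>R w) v - a * ?F (x + s *\<^sub>R v + 0 *\<^sub>R w) v"]
      dp has_derivative_at_withinI by blast
  obtain t where t: "t \<in> {0<..<h}"
    "?F (x + s *\<^sub>R v + h *\<^sub>R w) v - ?F (x + s *\<^sub>R v + 0 *\<^sub>R w) v = (h - 0) * ?G (x + s *\<^sub>R v + t *\<^sub>R w) w"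
    using mvt_simple[OF assms(1), of "\<lambda>t. ?F (x + s *\<^sub>R v + t *\<^sub>R w) v" "\<lambda>t a. a * ?G (x + s *\<^sub>R v + t *\<^sub>R w) w"]
      line' has_derivative_at_withinI s(1) by (metis greaterThanLessThan_iff less_eq_real_def)
  show thesis
  proof
    show "x + s *\<^sub>R v + t *\<^sub>R w \<in> ball x r" using s(1) t(1) by (intro inball) auto
    have "p h - p 0 = h * (h * ?G (x + s *\<^sub>R v + t *\<^sub>R w) w)"
      using s(2) t(2) by (simp flip: right_diff_distrib)
    then show "f (x + h *\<^sub>R v + h *\<^sub>R w) - f (x + h *\<^sub>R v) - f (x + h *\<^sub>R w) + f x
      = h\<^sup>2 * ?G (x + s *\<^sub>R v + t *\<^sub>R w) w"
      by (simp add: p_def power2_eq_square)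
  qed
qed

text \<open>Schwarz's theorem: for small \<open>h\<close> the same double difference equals \<open>h\<^sup>2\<close> times a value of
  \<open>\<partial>\<^sub>w \<partial>\<^sub>v f\<close> and \<open>h\<^sup>2\<close> times a value of \<open>\<partial>\<^sub>v \<partial>\<^sub>w f\<close>, both taken near \<open>x\<close>. By continuity these values
  are close to those at \<open>x\<close>.\<close>

lemma second_derivative_symmetric:
  fixes f :: "'b::euclidean_space \<Rightarrow> real"
  assumes "open S" "nCk_on 2 f S" "x \<in> S"
  shows "frechet_derivative (\<lambda>y. frechet_derivative f (at y) v) (at x) w
       = frechet_derivative (\<lambda>y. frechet_derivative f (at y) w) (at x) v"
proof -
  define H where "H a b y = frechet_derivative (\<lambda>y. frechet_derivative f (at y) a) (at y) b" for a b y
  have f: "\<And>y. y \<in> S \<Longrightarrow> f differentiable (at y)"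
    and f': "\<And>y a. y \<in> S \<Longrightarrow> (\<lambda>y. frechet_derivative f (at y) a) differentiable (at y)"
    and cont: "\<And>a b. continuous_on S (H a b)"
    using assms(2) by (auto simp: numeral_2_eq_2 H_def)
  have "\<bar>H v w x - H w v x\<bar> \<le> 0 + e" if "e > 0" for e :: real
  proof -
    have near: "\<exists>d>0. ball x d \<subseteq> S \<and> (\<forall>y\<in>ball x d. \<bar>H a b y - H a b x\<bar> < e / 2)" for a b
    proof -
      have "isCont (H a b) x"
        using cont assms(1,3) by (simp add: continuous_on_eq_continuous_at)
      then obtain d where d: "d > 0" "\<And>y. dist y x < d \<Longrightarrow> \<bar>H a b y - H a b x\<bar> < e / 2"
        unfolding continuous_at_eps_delta using \<open>e > 0\<close> by (metis dist_real_def half_gt_zero)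
      obtain d' where "d' > 0" "ball x d' \<subseteq> S" using assms(1,3) open_contains_ball by blast
      with d show ?thesis by (intro exI[of _ "min d d'"]) (auto simp: dist_commute)
    qed
    obtain d1 d2 where d: "d1 > 0" "ball x d1 \<subseteq> S" "\<And>y. y \<in> ball x d1 \<Longrightarrow> \<bar>H v w y - H v w x\<bar> < e / 2"
      "d2 > 0" "ball x d2 \<subseteq> S" "\<And>y. y \<in> ball x d2 \<Longrightarrow> \<bar>H w v y - H w v x\<bar> < e / 2"
      using near[of v w] near[of w v] by blast
    \<comment> \<open>The parallelogram must fit into both balls; the summand \<open>1\<close> covers \<open>v = w = 0\<close>.\<close>
    define h where "h = min d1 d2 / (norm v + norm w + 1)"
    have pos: "norm v + norm w + 1 > 0" by (simp add: add_nonneg_pos)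
    have h: "h > 0" using d(1,4) pos by (simp add: h_def)
    have eq: "h * (norm v + norm w) = min d1 d2 - h"
      using pos by (simp add: h_def field_simps)
    have small: "h * (norm v + norm w) < d1" "h * (norm w + norm v) < d2"
      using eq h by (simp_all add: add.commute)
    obtain z1 where z1: "z1 \<in> ball x d1"
      "f (x + h *\<^sub>R v + h *\<^sub>R w) - f (x + h *\<^sub>R v) - f (x + h *\<^sub>R w) + f x = h\<^sup>2 * H v w z1"
      using second_difference_mean_value[OF h small(1), of x f] f f' d(2) unfolding H_def by blast
    obtain z2 where z2: "z2 \<in> ball x d2"
      "f (x + h *\<^sub>R w + h *\<^sub>R v) - f (x + h *\<^sub>R w) - f (x + h *\<^sub>R v) + f x = h\<^sup>2 * H w v z2"
      using second_difference_mean_value[OF h small(2), of x f] f f' d(5) unfolding H_def by blast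
    have "h\<^sup>2 * H v w z1 = h\<^sup>2 * H w v z2"
      unfolding z1(2)[symmetric] z2(2)[symmetric] by (simp add: add.commute add.left_commute)
    then have "H v w z1 = H w v z2" using h by simp
    then show ?thesis using d(3)[OF z1(1)] d(6)[OF z2(1)] by linarith
  qed
  then have "\<bar>H v w x - H w v x\<bar> \<le> 0" by (rule field_le_epsilon)
  then show ?thesis by (simp add: H_def)
qed

text \<open>The Leibniz rule applied to \<open>\<Sum>\<^sub>b Y\<^sub>b \<partial>\<^sub>b f\<close>. The double sum is the Hessian of \<open>f\<close>, the part that
  cancels in a commutator.\<close>

lemma frechet_derivative_directional_derivative:
  fixes f :: "'b::euclidean_space \<Rightarrow> real"
  assumes "open S" "nCk_on 2 f S" "nCk_on 1 Y S" "x \<in> S"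
  shows "frechet_derivative (\<lambda>y. frechet_derivative f (at y) (Y y)) (at x) v
       = frechet_derivative f (at x) (frechet_derivative Y (at x) v)
       + (\<Sum>a\<in>Basis. \<Sum>b\<in>Basis. (v \<bullet> a) * (Y x \<bullet> b)
            * frechet_derivative (\<lambda>y. frechet_derivative f (at y) b) (at x) a)"
proof -
  let ?F = "\<lambda>y. frechet_derivative f (at y)"
  let ?H = "\<lambda>b. frechet_derivative (\<lambda>y. frechet_derivative f (at y) b) (at x)"
  have f: "\<And>y. y \<in> S \<Longrightarrow> f differentiable (at y)"
    and f': "\<And>b. (\<lambda>y. ?F y b) differentiable (at x)"
    and Y: "Y differentiable (at x)"
    using assms(2-4) by (auto simp: numeral_2_eq_2)
  have "((\<lambda>y. \<Sum>b\<in>Basis. (Y y \<bullet> b) * ?F y b) has_derivative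
      (\<lambda>v. \<Sum>b\<in>Basis. (Y x \<bullet> b) * ?H b v + (frechet_derivative Y (at x) v \<bullet> b) * ?F x b)) (at x)"
    using f' Y unfolding frechet_derivative_works
    by (intro has_derivative_sum has_derivative_mult has_derivative_inner_left) auto
  moreover have "(\<Sum>b\<in>Basis. (Y y \<bullet> b) * ?F y b) = ?F y (Y y)" if "y \<in> S" for y
    using frechet_derivative_eq_sum_Basis[OF f[OF that], of "Y y"] by simp
  ultimately have "((\<lambda>y. ?F y (Y y)) has_derivative
      (\<lambda>v. \<Sum>b\<in>Basis. (Y x \<bullet> b) * ?H b v + (frechet_derivative Y (at x) v \<bullet> b) * ?F x b)) (at x)"
    by (rule has_derivative_transform_within_open[OF _ assms(1,4)])
  then have "frechet_derivative (\<lambda>y. ?F y (Y y)) (at x) v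
      = (\<Sum>b\<in>Basis. (Y x \<bullet> b) * ?H b v) + (\<Sum>b\<in>Basis. (frechet_derivative Y (at x) v \<bullet> b) * ?F x b)"
    by (simp add: frechet_derivative_eqI sum.distrib)
  also have "(\<Sum>b\<in>Basis. (frechet_derivative Y (at x) v \<bullet> b) * ?F x b) = ?F x (frechet_derivative Y (at x) v)"
    using frechet_derivative_eq_sum_Basis[OF f[OF assms(4)], of "frechet_derivative Y (at x) v"] by simp
  also have "(\<Sum>b\<in>Basis. (Y x \<bullet> b) * ?H b v)
      = (\<Sum>b\<in>Basis. \<Sum>a\<in>Basis. (v \<bullet> a) * (Y x \<bullet> b) * ?H b a)"
    by (intro sum.cong refl, subst frechet_derivative_eq_sum_Basis[OF f'])
      (simp add: sum_distrib_left mult_ac)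
  also have "\<dots> = (\<Sum>a\<in>Basis. \<Sum>b\<in>Basis. (v \<bullet> a) * (Y x \<bullet> b) * ?H b a)"
    by (rule sum.swap)
  finally show ?thesis by simp
qed

text \<open>This is \<open>X (Y f) - Y (X f) = [X, Y] f\<close> in a coordinate domain; the two Hessian terms agree by
  Schwarz's theorem.\<close>

lemma commutator_directional_derivatives:
  fixes f :: "'b::euclidean_space \<Rightarrow> real"
  assumes "open S" "nCk_on 2 f S" "nCk_on 1 X S" "nCk_on 1 Y S" "x \<in> S"
  shows "frechet_derivative (\<lambda>y. frechet_derivative f (at y) (Y y)) (at x) (X x)
       - frechet_derivative (\<lambda>y. frechet_derivative f (at y) (X y)) (at x) (Y x)
       = frechet_derivative f (at x)
          (frechet_derivative Y (at x) (X x) - frechet_derivative X (at x) (Y x))"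
proof -
  let ?H = "\<lambda>b. frechet_derivative (\<lambda>y. frechet_derivative f (at y) b) (at x)"
  have "(\<Sum>a\<in>Basis. \<Sum>b\<in>Basis. (X x \<bullet> a) * (Y x \<bullet> b) * ?H b a)
      = (\<Sum>b\<in>Basis. \<Sum>a\<in>Basis. (X x \<bullet> a) * (Y x \<bullet> b) * ?H b a)"
    by (rule sum.swap)
  also have "\<dots> = (\<Sum>b\<in>Basis. \<Sum>a\<in>Basis. (Y x \<bullet> b) * (X x \<bullet> a) * ?H a b)"
    by (intro sum.cong refl) (simp add: mult_ac second_derivative_symmetric[OF assms(1,2,5)])
  finally have sym: "(\<Sum>a\<in>Basis. \<Sum>b\<in>Basis. (X x \<bullet> a) * (Y x \<bullet> b) * ?H b a)
      = (\<Sum>b\<in>Basis. \<Sum>a\<in>Basis. (Y x \<bullet> b) * (X x \<bullet> a) * ?H a b)" .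
  have "f differentiable (at x)" using assms(2,5) by (simp add: numeral_2_eq_2)
  note lin = linear_frechet_derivative[OF this]
  show ?thesis
    unfolding frechet_derivative_directional_derivative[OF assms(1,2,3,5)]
      frechet_derivative_directional_derivative[OF assms(1,2,4,5)] linear_diff[OF lin] sym
    by simp
qed

section \<open>The classes \<open>C\<^sup>k\<close> for extended exponents\<close>

lemma Ck_on_mono: "Ck_on k f S \<Longrightarrow> l \<le> k \<Longrightarrow> Ck_on l f S"
  unfolding Ck_on_def by (meson order_trans)

lemma Ck_on_nCk_on: "Ck_on k f S \<Longrightarrow> enat n \<le> k \<Longrightarrow> nCk_on n f S"
  by (simp add: Ck_on_def)

lemma Ck_on_cong: "open S \<Longrightarrow> (\<And>x. x \<in> S \<Longrightarrow> f x = g x) \<Longrightarrow> Ck_on k f S \<Longrightarrow> Ck_on k g S"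
  unfolding Ck_on_def by (blast intro: nCk_on_cong)

lemma Ck_on_add: "open S \<Longrightarrow> Ck_on k f S \<Longrightarrow> Ck_on k g S \<Longrightarrow> Ck_on k (\<lambda>x. f x + g x) S"
  unfolding Ck_on_def by (simp add: nCk_on_add)

lemma Ck_on_scaleR:
  fixes f :: "'b::euclidean_space \<Rightarrow> real"
  shows "open S \<Longrightarrow> Ck_on k f S \<Longrightarrow> Ck_on k g S \<Longrightarrow> Ck_on k (\<lambda>x. f x *\<^sub>R g x) S"
  unfolding Ck_on_def by (simp add: nCk_on_scaleR)

lemma Ck_on_mult:
  fixes f g :: "'b::euclidean_space \<Rightarrow> real"
  shows "open S \<Longrightarrow> Ck_on k f S \<Longrightarrow> Ck_on k g S \<Longrightarrow> Ck_on k (\<lambda>x. f x * g x) S"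
  using Ck_on_scaleR[of S k f g] by simp

lemma Ck_on_directional_derivative:
  assumes "open S" "Ck_on (k + 1) f S" "Ck_on k Y S"
  shows "Ck_on k (\<lambda>x. frechet_derivative f (at x) (Y x)) S"
  unfolding Ck_on_def
proof (intro allI impI)
  fix n assume n: "enat n \<le> k"
  then have "enat (Suc n) \<le> k + 1"
    by (metis add_right_mono eSuc_enat plus_1_eSuc(2))
  then show "nCk_on n (\<lambda>x. frechet_derivative f (at x) (Y x)) S"
    using assms n by (intro nCk_on_directional_derivative) (auto simp: Ck_on_def)
qed

section \<open>Charts and tangent vectors\<close>

lemma chart_inv_chart: "is_chart c \<Longrightarrow> p \<in> fst c \<Longrightarrow> chart_inv c (snd c p) = p"
  unfolding is_chart_def homeomorphism_def by blast

lemma chart_inv_in_domain: "x \<in> chart_img c \<Longrightarrow> chart_inv c x \<in> fst c"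
  by (rule inv_into_into)

lemma chart_chart_inv: "x \<in> chart_img c \<Longrightarrow> snd c (chart_inv c x) = x"
  by (rule f_inv_into_f)

lemma open_chart_img: "is_chart c \<Longrightarrow> open (chart_img c)"
  by (simp add: is_chart_def)

lemma open_chart_overlap:
  assumes "is_chart c" "is_chart d"
  shows "open (snd c ` (fst c \<inter> fst d))"
proof -
  have "snd c ` (fst c \<inter> fst d) = chart_img c \<inter> chart_inv c -` (fst c \<inter> fst d)"
  proof (intro subset_antisym subsetI)
    show "x \<in> chart_img c \<inter> chart_inv c -` (fst c \<inter> fst d)" if "x \<in> snd c ` (fst c \<inter> fst d)" for x
      using that assms(1) by (auto simp: chart_inv_chart)
    show "x \<in> snd c ` (fst c \<inter> fst d)" if "x \<in> chart_img c \<inter> chart_inv c -` (fst c \<inter> fst d)" for x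
      using that chart_chart_inv[of x c] by (metis IntE image_eqI vimageE)
  qed
  moreover have "continuous_on (chart_img c) (chart_inv c)"
    using assms(1) by (simp add: is_chart_def homeomorphism_def)
  ultimately show ?thesis
    using assms by (metis continuous_open_preimage is_chart_def open_Int)
qed

lemma atlas_chart: "smooth_atlas A \<Longrightarrow> c \<in> A \<Longrightarrow> is_chart c"
  by (simp add: smooth_atlas_def)

lemma atlas_chart_at:
  assumes "smooth_atlas A"
  obtains c where "c \<in> A" "p \<in> fst c"
  using assms unfolding smooth_atlas_def by blast

lemma differentiable_transition:
  assumes "smooth_atlas A" "c \<in> A" "d \<in> A" "p \<in> fst c \<inter> fst d"
  shows "transition c d differentiable (at (snd c p))"
proof -
  have "nCk_on (Suc 0) (transition c d) (snd c ` (fst c \<inter> fst d))"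
    using assms by (simp add: smooth_atlas_def Ck_on_def del: nCk_on.simps)
  then show ?thesis using assms(4) by auto
qed

lemma linear_frechet_derivative_transition:
  assumes "smooth_atlas A" "c \<in> A" "d \<in> A" "p \<in> fst c \<inter> fst d"
  shows "linear (frechet_derivative (transition c d) (at (snd c p)))"
  by (rule linear_frechet_derivative[OF differentiable_transition[OF assms]])

lemma tangent_spaceI:
  assumes "\<And>c. \<not> (c \<in> A \<and> p \<in> fst c) \<Longrightarrow> v c = 0"
    and "\<And>c d. c \<in> A \<Longrightarrow> d \<in> A \<Longrightarrow> p \<in> fst c \<inter> fst d \<Longrightarrow>
      v d = frechet_derivative (transition c d) (at (snd c p)) (v c)"
  shows "v \<in> tangent_space A p"
  unfolding tangent_space_def using assms by blast

lemma tangent_space_outside: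
  "v \<in> tangent_space A p \<Longrightarrow> \<not> (c \<in> A \<and> p \<in> fst c) \<Longrightarrow> v c = 0"
  unfolding tangent_space_def by blast

lemma tangent_space_transition:
  assumes "v \<in> tangent_space A p" "c \<in> A" "d \<in> A" "p \<in> fst c \<inter> fst d"
  shows "frechet_derivative (transition c d) (at (snd c p)) (v c) = v d"
  by (rule sym) (use assms in \<open>unfold tangent_space_def, blast\<close>)

lemma tangent_space_add:
  assumes "smooth_atlas A" "u \<in> tangent_space A p" "v \<in> tangent_space A p"
  shows "u + v \<in> tangent_space A p"
proof (rule tangent_spaceI)
  show "(u + v) c = 0" if "\<not> (c \<in> A \<and> p \<in> fst c)" for c
    using tangent_space_outside[OF assms(2) that] tangent_space_outside[OF assms(3) that] by simp
  show "(u + v) d = frechet_derivative (transition c d) (at (snd c p)) ((u + v) c)"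
    if "c \<in> A" "d \<in> A" "p \<in> fst c \<inter> fst d" for c d
    using tangent_space_transition[OF assms(2) that] tangent_space_transition[OF assms(3) that]
    by (simp add: linear_add[OF linear_frechet_derivative_transition[OF assms(1) that]])
qed

lemma fscale_apply: "fscale f X p c = f p *\<^sub>R X p c"
  by (simp add: fscale_def tscale_def)

lemma tangent_space_tscale:
  assumes "smooth_atlas A" "v \<in> tangent_space A p"
  shows "tscale a v \<in> tangent_space A p"
proof (rule tangent_spaceI)
  show "tscale a v c = 0" if "\<not> (c \<in> A \<and> p \<in> fst c)" for c
    using tangent_space_outside[OF assms(2) that] by (simp add: tscale_def)
  show "tscale a v d = frechet_derivative (transition c d) (at (snd c p)) (tscale a v c)"
    if "c \<in> A" "d \<in> A" "p \<in> fst c \<inter> fst d" for c d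
    using tangent_space_transition[OF assms(2) that]
    by (simp add: tscale_def linear_cmul[OF linear_frechet_derivative_transition[OF assms(1) that]])
qed

section \<open>Functions and vector fields of class \<open>C\<^sup>k\<close>\<close>

lemma Ck_fun_mono: "Ck_fun A k f \<Longrightarrow> l \<le> k \<Longrightarrow> Ck_fun A l f"
  unfolding Ck_fun_def by (blast intro: Ck_on_mono)

lemma Ck_vfield_mono: "Ck_vfield A k X \<Longrightarrow> l \<le> k \<Longrightarrow> Ck_vfield A l X"
  unfolding Ck_vfield_def by (blast intro: Ck_on_mono)

lemma Ck_vfield_of_smooth: "Ck_vfield A \<infinity> X \<Longrightarrow> Ck_vfield A k X"
  by (erule Ck_vfield_mono) simp

lemma Ck_fun_mult:
  assumes "smooth_atlas A" "Ck_fun A k f" "Ck_fun A k h"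
  shows "Ck_fun A k (\<lambda>p. f p * h p)"
  using assms(2,3) open_chart_img[OF atlas_chart[OF assms(1)]] unfolding Ck_fun_def
  by (auto intro: Ck_on_mult)

lemma Ck_fun_const: "Ck_fun A k (\<lambda>p. a)"
  by (simp add: Ck_fun_def Ck_on_def nCk_on_const)

lemma Ck_fun_uminus:
  assumes "smooth_atlas A" "Ck_fun A k f"
  shows "Ck_fun A k (\<lambda>p. - f p)"
proof -
  from Ck_fun_mult[OF assms(1) Ck_fun_const[of A k "-1"] assms(2)] show ?thesis by simp
qed

lemma Ck_vfield_add:
  assumes "smooth_atlas A" "Ck_vfield A k X" "Ck_vfield A k Y"
  shows "Ck_vfield A k (X + Y)"
proof -
  have "local_rep (X + Y) c = (\<lambda>x. local_rep X c x + local_rep Y c x)" for c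
    by (simp add: local_rep_def)
  then show ?thesis
    using assms open_chart_img[OF atlas_chart[OF assms(1)]] unfolding Ck_vfield_def
    by (auto intro: Ck_on_add tangent_space_add)
qed

lemma Ck_vfield_fscale:
  assumes "smooth_atlas A" "Ck_fun A k f" "Ck_vfield A k X"
  shows "Ck_vfield A k (fscale f X)"
proof -
  have "local_rep (fscale f X) c = (\<lambda>x. f (chart_inv c x) *\<^sub>R local_rep X c x)" for c
    by (simp add: local_rep_def fscale_def tscale_def)
  then show ?thesis
    using assms open_chart_img[OF atlas_chart[OF assms(1)]] unfolding Ck_vfield_def Ck_fun_def
    by (auto intro: Ck_on_scaleR tangent_space_tscale simp: fscale_def)
qed

section \<open>Vector fields as derivations\<close>

lemma differentiable_in_chart:
  assumes "Ck_fun A 1 f" "c \<in> A" "p \<in> fst c"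
  shows "(\<lambda>x. f (chart_inv c x)) differentiable (at (snd c p))"
  using assms Ck_on_nCk_on[of 1 "\<lambda>x. f (chart_inv c x)" "chart_img c" 1] by (auto simp: Ck_fun_def one_enat_def)

lemma differentiable_local_rep:
  assumes "Ck_vfield A 1 X" "c \<in> A" "p \<in> fst c"
  shows "local_rep X c differentiable (at (snd c p))"
  using assms Ck_on_nCk_on[of 1 "local_rep X c" "chart_img c" 1] by (auto simp: Ck_vfield_def one_enat_def)

text \<open>One chart serves for all fields and functions at \<open>p\<close>, so identities that are pointwise linear
  in the derivative follow without any comparison of charts.\<close>

lemma vderiv_chart_at:
  fixes A :: "('m::topological_space, 'b::euclidean_space) chart set"
  assumes "smooth_atlas A"
  obtains c where "c \<in> A" "p \<in> fst c"
    "\<And>X f. vderiv A X f p = frechet_derivative (\<lambda>x. f (chart_inv c x)) (at (snd c p)) (X p c)"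
proof -
  define c where "c = (SOME c. c \<in> A \<and> p \<in> fst c)"
  obtain d where "d \<in> A" "p \<in> fst d" using atlas_chart_at[OF assms] .
  then have "c \<in> A \<and> p \<in> fst c" unfolding c_def by (intro someI) blast
  then show thesis by (intro that[of c]) (simp_all add: vderiv_def Let_def flip: c_def)
qed

text \<open>The components of a tangent vector in two charts are related by the differential of the
  transition map, which cancels against the one that the chain rule produces. The selected chart may
  jump from point to point, so this is what allows \<open>X f\<close> to be differentiated a second time.\<close>

lemma vderiv_in_chart:
  assumes A: "smooth_atlas A" and f: "Ck_fun A 1 f" and X: "X p \<in> tangent_space A p"
    and c: "c \<in> A" "p \<in> fst c"
  shows "vderiv A X f p = frechet_derivative (\<lambda>x. f (chart_inv c x)) (at (snd c p)) (X p c)"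
proof -
  obtain d where d: "d \<in> A" "p \<in> fst d"
    and vd: "\<And>X f. vderiv A X f p = frechet_derivative (\<lambda>x. f (chart_inv d x)) (at (snd d p)) (X p d)"
    using vderiv_chart_at[OF A] by blast
  let ?fc = "\<lambda>x. f (chart_inv c x)" and ?T = "transition d c"
  have T: "?T differentiable (at (snd d p))"
    using differentiable_transition[OF A d(1) c(1)] c d by simp
  have Tp: "?T (snd d p) = snd c p"
    using d A by (simp add: transition_def chart_inv_chart atlas_chart)
  have fc: "?fc differentiable (at (?T (snd d p)))"
    unfolding Tp by (rule differentiable_in_chart[OF f c])
  have eq: "(?fc \<circ> ?T) x = f (chart_inv d x)" if "x \<in> snd d ` (fst d \<inter> fst c)" for x
    using that c d A by (auto simp: transition_def chart_inv_chart atlas_chart)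
  have "frechet_derivative (\<lambda>x. f (chart_inv d x)) (at (snd d p))
      = frechet_derivative (?fc \<circ> ?T) (at (snd d p))"
  proof (rule frechet_derivative_transform_within_open[symmetric])
    show "?fc \<circ> ?T differentiable at (snd d p)" using T fc by (rule differentiable_chain_at)
    show "open (snd d ` (fst d \<inter> fst c))" using A c d by (simp add: open_chart_overlap atlas_chart)
    show "snd d p \<in> snd d ` (fst d \<inter> fst c)" using c d by blast
  qed (rule eq)
  also have "\<dots> = frechet_derivative ?fc (at (snd c p)) \<circ> frechet_derivative ?T (at (snd d p))"
    using frechet_derivative_compose[OF T fc] by (simp add: Tp)
  finally have "frechet_derivative (\<lambda>x. f (chart_inv d x)) (at (snd d p)) (X p d)
      = frechet_derivative ?fc (at (snd c p)) (X p c)"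
    using tangent_space_transition[OF X d(1) c(1)] c d by simp
  then show ?thesis by (simp add: vd)
qed

lemma vderiv_local:
  assumes "smooth_atlas A" "Ck_fun A 1 f" "Ck_vfield A k X" "c \<in> A" "x \<in> chart_img c"
  shows "vderiv A X f (chart_inv c x)
    = frechet_derivative (\<lambda>x. f (chart_inv c x)) (at x) (local_rep X c x)"
  using vderiv_in_chart[OF assms(1,2) _ assms(4), of X "chart_inv c x"] assms(3,5)
  by (simp add: Ck_vfield_def chart_inv_in_domain chart_chart_inv local_rep_def)

lemma Ck_fun_vderiv:
  assumes "smooth_atlas A" "Ck_fun A (k + 1) f" "Ck_vfield A k X"
  shows "Ck_fun A k (vderiv A X f)"
  unfolding Ck_fun_def
proof
  fix c assume c: "c \<in> A"
  note o = open_chart_img[OF atlas_chart[OF assms(1) c]]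
  have f: "Ck_fun A 1 f" using assms(2) by (rule Ck_fun_mono) simp
  show "Ck_on k (\<lambda>x. vderiv A X f (chart_inv c x)) (chart_img c)"
  proof (rule Ck_on_cong[OF o])
    show "Ck_on k (\<lambda>x. frechet_derivative (\<lambda>x. f (chart_inv c x)) (at x) (local_rep X c x)) (chart_img c)"
      using assms(2,3) c o by (intro Ck_on_directional_derivative) (auto simp: Ck_fun_def Ck_vfield_def)
  qed (simp add: vderiv_local[OF assms(1) f assms(3) c])
qed

lemma vderiv_mult:
  assumes "smooth_atlas A" "Ck_fun A 1 f" "Ck_fun A 1 h"
  shows "vderiv A X (\<lambda>p. f p * h p) p = f p * vderiv A X h p + vderiv A X f p * h p"
proof -
  obtain c where c: "c \<in> A" "p \<in> fst c"
    and vc: "\<And>X f. vderiv A X f p = frechet_derivative (\<lambda>x. f (chart_inv c x)) (at (snd c p)) (X p c)"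
    using vderiv_chart_at[OF assms(1)] by blast
  have "((\<lambda>x. f (chart_inv c x) * h (chart_inv c x)) has_derivative
     (\<lambda>v. f (chart_inv c (snd c p)) * frechet_derivative (\<lambda>x. h (chart_inv c x)) (at (snd c p)) v
        + frechet_derivative (\<lambda>x. f (chart_inv c x)) (at (snd c p)) v * h (chart_inv c (snd c p))))
     (at (snd c p))"
    using differentiable_in_chart[OF assms(2) c] differentiable_in_chart[OF assms(3) c]
    unfolding frechet_derivative_works by (rule has_derivative_mult)
  then show ?thesis
    using c assms(1)
    by (simp add: vc frechet_derivative_eqI chart_inv_chart atlas_chart)
qed

lemma vderiv_fscale:
  assumes "smooth_atlas A" "Ck_fun A 1 f"
  shows "vderiv A (fscale h X) f p = h p * vderiv A X f p"
proof -
  obtain c where c: "c \<in> A" "p \<in> fst c"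
    and vc: "\<And>X f. vderiv A X f p = frechet_derivative (\<lambda>x. f (chart_inv c x)) (at (snd c p)) (X p c)"
    using vderiv_chart_at[OF assms(1)] by blast
  show ?thesis
    using linear_cmul[OF linear_frechet_derivative[OF differentiable_in_chart[OF assms(2) c]]]
    by (simp add: vc fscale_apply)
qed

lemma vderiv_add:
  assumes "smooth_atlas A" "Ck_fun A 1 f"
  shows "vderiv A (X + Y) f p = vderiv A X f p + vderiv A Y f p"
proof -
  obtain c where c: "c \<in> A" "p \<in> fst c"
    and vc: "\<And>X f. vderiv A X f p = frechet_derivative (\<lambda>x. f (chart_inv c x)) (at (snd c p)) (X p c)"
    using vderiv_chart_at[OF assms(1)] by blast
  show ?thesis
    using linear_add[OF linear_frechet_derivative[OF differentiable_in_chart[OF assms(2) c]]]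
    by (simp add: vc)
qed

text \<open>Written in one chart around \<open>p\<close>, this is the commutator identity in a Euclidean domain. The
  tangency premise makes \<open>[X, Y] f\<close> independent of the chart; for smooth fields it will come from a
  torsion-free connection.\<close>

lemma vderiv_lie_bracket:
  assumes A: "smooth_atlas A" and f: "Ck_fun A 2 f" and X: "Ck_vfield A 1 X" and Y: "Ck_vfield A 1 Y"
    and tangent: "lie_bracket A X Y p \<in> tangent_space A p"
  shows "vderiv A (lie_bracket A X Y) f p = vderiv A X (vderiv A Y f) p - vderiv A Y (vderiv A X f) p"
proof -
  obtain c where c: "c \<in> A" "p \<in> fst c" using atlas_chart_at[OF A] .
  let ?S = "chart_img c" and ?f = "\<lambda>x. f (chart_inv c x)" and ?x = "snd c p"
  have p: "chart_inv c ?x = p" using A c by (simp add: chart_inv_chart atlas_chart)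
  have rep: "local_rep V c ?x = V p c" for V by (simp add: local_rep_def p)
  note o = open_chart_img[OF atlas_chart[OF A c(1)]]
  have f1: "Ck_fun A 1 f" using f by (rule Ck_fun_mono) simp
  have f2: "Ck_fun A (1 + 1) f" using f by simp
  have iterated: "vderiv A V (vderiv A W f) p
      = frechet_derivative (\<lambda>y. frechet_derivative ?f (at y) (local_rep W c y)) (at ?x) (local_rep V c ?x)"
    if V: "Ck_vfield A 1 V" and W: "Ck_vfield A 1 W" for V W
  proof -
    have Wf: "Ck_fun A 1 (vderiv A W f)" by (rule Ck_fun_vderiv[OF A f2 W])
    have "vderiv A V (vderiv A W f) p
        = frechet_derivative (\<lambda>x. vderiv A W f (chart_inv c x)) (at ?x) (local_rep V c ?x)"
      using vderiv_local[OF A Wf V c(1), of ?x] c(2) p by simp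
    also have "frechet_derivative (\<lambda>x. vderiv A W f (chart_inv c x)) (at ?x)
        = frechet_derivative (\<lambda>y. frechet_derivative ?f (at y) (local_rep W c y)) (at ?x)"
      by (rule frechet_derivative_transform_within_open[OF differentiable_in_chart[OF Wf c] o])
        (use c(2) in \<open>auto simp: vderiv_local[OF A f1 W c(1)]\<close>)
    finally show ?thesis .
  qed
  have "vderiv A X (vderiv A Y f) p - vderiv A Y (vderiv A X f) p
     = frechet_derivative ?f (at ?x) (frechet_derivative (local_rep Y c) (at ?x) (local_rep X c ?x)
         - frechet_derivative (local_rep X c) (at ?x) (local_rep Y c ?x))"
    unfolding iterated[OF X Y] iterated[OF Y X]
  proof (rule commutator_directional_derivatives[OF o])
    show "nCk_on 2 ?f ?S" using f c(1) by (auto simp: Ck_fun_def Ck_on_def numeral_eq_enat)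
    show "nCk_on 1 (local_rep X c) ?S" "nCk_on 1 (local_rep Y c) ?S"
      using X Y c(1) by (auto simp: Ck_vfield_def one_enat_def simp del: nCk_on.simps
          intro!: Ck_on_nCk_on[of "enat 1"])
    show "?x \<in> ?S" using c(2) by simp
  qed
  also have "\<dots> = vderiv A (lie_bracket A X Y) f p"
    unfolding vderiv_in_chart[where X = "lie_bracket A X Y" and p = p, OF A f1 tangent c]
    using c rep by (simp add: lie_bracket_def)
  finally show ?thesis by simp
qed

lemma frechet_derivative_local_rep_fscale:
  assumes A: "smooth_atlas A" and f: "Ck_fun A 1 f" and X: "X p \<in> tangent_space A p" and Y: "Ck_vfield A 1 Y"
    and c: "c \<in> A" "p \<in> fst c"
  shows "frechet_derivative (local_rep (fscale f Y) c) (at (snd c p)) (X p c)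
     = f p *\<^sub>R frechet_derivative (local_rep Y c) (at (snd c p)) (X p c) + vderiv A X f p *\<^sub>R Y p c"
proof -
  let ?f = "\<lambda>x. f (chart_inv c x)" and ?x = "snd c p"
  have p: "chart_inv c ?x = p" using A c by (simp add: chart_inv_chart atlas_chart)
  have "local_rep (fscale f Y) c = (\<lambda>x. ?f x *\<^sub>R local_rep Y c x)"
    by (simp add: local_rep_def fscale_def tscale_def)
  moreover have "((\<lambda>x. ?f x *\<^sub>R local_rep Y c x) has_derivative
      (\<lambda>v. ?f ?x *\<^sub>R frechet_derivative (local_rep Y c) (at ?x) v
         + frechet_derivative ?f (at ?x) v *\<^sub>R local_rep Y c ?x)) (at ?x)"
    using differentiable_in_chart[OF f c] differentiable_local_rep[OF Y c]
    unfolding frechet_derivative_works by (rule has_derivative_scaleR)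
  ultimately show ?thesis
    by (simp add: frechet_derivative_eqI vderiv_in_chart[where X = X and p = p, OF A f X c] p) (simp add: local_rep_def p)
qed

text \<open>In a chart around \<open>p\<close> the Leibniz rule splits off derivatives of \<open>f\<close>, which are the values of
  \<open>X f\<close> and \<open>Y f\<close> because these can be computed in any chart. In all other charts both sides vanish
  by convention.\<close>

lemma lie_bracket_fscale:
  assumes A: "smooth_atlas A" and f: "Ck_fun A 1 f" and X: "Ck_vfield A 1 X" and Y: "Ck_vfield A 1 Y"
  shows "lie_bracket A (fscale f X) (fscale f Y)
     = fscale (\<lambda>p. f p * f p) (lie_bracket A X Y)
       + fscale (\<lambda>p. f p * vderiv A X f p) Y + fscale (\<lambda>p. - (f p * vderiv A Y f p)) X"
proof (intro ext)
  fix p c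
  have Xp: "X p \<in> tangent_space A p" and Yp: "Y p \<in> tangent_space A p"
    using X Y by (auto simp: Ck_vfield_def)
  show "lie_bracket A (fscale f X) (fscale f Y) p c
     = (fscale (\<lambda>p. f p * f p) (lie_bracket A X Y)
       + fscale (\<lambda>p. f p * vderiv A X f p) Y + fscale (\<lambda>p. - (f p * vderiv A Y f p)) X) p c"
  proof (cases "c \<in> A \<and> p \<in> fst c")
    case True
    then have c: "c \<in> A" "p \<in> fst c" by auto
    have at_p: "lie_bracket A (fscale f X) (fscale f Y) p c
      = f p *\<^sub>R frechet_derivative (local_rep (fscale f Y) c) (at (snd c p)) (X p c)
      - f p *\<^sub>R frechet_derivative (local_rep (fscale f X) c) (at (snd c p)) (Y p c)"
      using c differentiable_local_rep[OF Ck_vfield_fscale[OF A f] c] X Y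
      by (simp add: lie_bracket_def fscale_apply
          linear_cmul[OF linear_frechet_derivative])
    show ?thesis
      unfolding at_p frechet_derivative_local_rep_fscale[where X = X and p = p, OF A f Xp Y c]
        frechet_derivative_local_rep_fscale[where X = Y and p = p, OF A f Yp X c]
      using c by (simp add: lie_bracket_def fscale_apply algebra_simps)
  next
    case False
    then show ?thesis
      using tangent_space_outside[OF Xp False] tangent_space_outside[OF Yp False]
      by (simp only: lie_bracket_def if_False fscale_apply plus_fun_apply) simp
  qed
qed

section \<open>Curvature of rescaled fields\<close>

lemma affine_connectionD:
  assumes "affine_connection A D"
  shows affine_connection_smooth:
      "Ck_vfield A k X \<Longrightarrow> Ck_vfield A (k + 1) Y \<Longrightarrow> Ck_vfield A k (D X Y)"
    and affine_connection_add_left: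
      "Ck_vfield A 0 X \<Longrightarrow> Ck_vfield A 0 X' \<Longrightarrow> Ck_vfield A 1 Y \<Longrightarrow> D (X + X') Y = D X Y + D X' Y"
    and affine_connection_fscale_left:
      "Ck_fun A 0 f \<Longrightarrow> Ck_vfield A 0 X \<Longrightarrow> Ck_vfield A 1 Y \<Longrightarrow> D (fscale f X) Y = fscale f (D X Y)"
    and affine_connection_add_right:
      "Ck_vfield A 0 X \<Longrightarrow> Ck_vfield A 1 Y \<Longrightarrow> Ck_vfield A 1 Y' \<Longrightarrow> D X (Y + Y') = D X Y + D X Y'"
    and affine_connection_fscale_right:
      "Ck_fun A 1 f \<Longrightarrow> Ck_vfield A 0 X \<Longrightarrow> Ck_vfield A 1 Y \<Longrightarrow>
        D X (fscale f Y) = fscale (vderiv A X f) Y + fscale f (D X Y)"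
  using assms unfolding affine_connection_def by blast+

text \<open>The bracket of smooth fields equals \<open>D X Y - D Y X\<close>. So its components change from chart to chart
  as those of a tangent vector must, because those of \<open>D X Y\<close> and \<open>D Y X\<close> do.\<close>

lemma Ck_vfield_lie_bracket:
  assumes "smooth_atlas A" "affine_connection A D" "torsion_free A D"
    and "Ck_vfield A \<infinity> X" "Ck_vfield A \<infinity> Y"
  shows "Ck_vfield A \<infinity> (lie_bracket A X Y)"
proof -
  have "Ck_vfield A \<infinity> (D X Y + fscale (\<lambda>p. -1) (D Y X))"
    using assms by (intro Ck_vfield_add Ck_vfield_fscale Ck_fun_const affine_connection_smooth[OF assms(2)]) auto
  also have "D X Y + fscale (\<lambda>p. -1) (D Y X) = D X Y - D Y X"
    by (intro ext) (simp add: fscale_apply)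
  also have "\<dots> = lie_bracket A X Y"
    using assms(3-5) unfolding torsion_free_def by blast
  finally show ?thesis .
qed

text \<open>The first application of the product rule gives \<open>D\<^bsub>f Y\<^esub> (f Z) = f (Y f) Z + f\<^sup>2 D\<^sub>Y Z\<close>, the second
  differentiates both coefficients. The coefficient \<open>f (Y f)\<close> has to be of class \<open>C\<^sup>1\<close>, hence the
  assumption that \<open>f\<close> is of class \<open>C\<^sup>2\<close>.\<close>

lemma iterated_connection_fscale:
  assumes A: "smooth_atlas A" and D: "affine_connection A D" and f: "Ck_fun A 2 f"
    and X: "Ck_vfield A \<infinity> X" and Y: "Ck_vfield A \<infinity> Y" and Z: "Ck_vfield A \<infinity> Z"
  shows "D (fscale f X) (D (fscale f Y) (fscale f Z)) p c
    = (f p * (f p * vderiv A X (vderiv A Y f) p + vderiv A X f p * vderiv A Y f p)) *\<^sub>R Z p c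
      + ((f p)\<^sup>2 * vderiv A Y f p) *\<^sub>R D X Z p c
      + (2 * (f p)\<^sup>2 * vderiv A X f p) *\<^sub>R D Y Z p c
      + (f p ^ 3) *\<^sub>R D X (D Y Z) p c"
proof -
  note le = Ck_vfield_of_smooth
  have f1: "Ck_fun A 1 f" and f0: "Ck_fun A 0 f" using f by (auto intro: Ck_fun_mono)
  have Yf: "Ck_fun A 1 (vderiv A Y f)"
    using f by (intro Ck_fun_vderiv[OF A] le[OF Y]) simp
  have DYZ: "Ck_vfield A \<infinity> (D Y Z)"
    using Y Z by (intro affine_connection_smooth[OF D]) auto
  have fYf: "Ck_fun A 1 (\<lambda>p. f p * vderiv A Y f p)" and ff: "Ck_fun A 1 (\<lambda>p. f p * f p)"
    by (intro Ck_fun_mult[OF A] f1 Yf)+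
  have inner: "D (fscale f Y) (fscale f Z)
      = fscale (\<lambda>p. f p * vderiv A Y f p) Z + fscale (\<lambda>p. f p * f p) (D Y Z)"
  proof -
    have "D (fscale f Y) (fscale f Z) = fscale f (D Y (fscale f Z))"
      by (intro affine_connection_fscale_left[OF D] f0 le[OF Y] Ck_vfield_fscale[OF A f1 le[OF Z]])
    also have "\<dots> = fscale f (fscale (vderiv A Y f) Z + fscale f (D Y Z))"
      by (subst affine_connection_fscale_right[OF D f1 le[OF Y] le[OF Z]]) simp
    finally show ?thesis by (simp add: fun_eq_iff fscale_apply scaleR_add_right)
  qed
  have "D (fscale f X) (D (fscale f Y) (fscale f Z))
      = fscale f (D X (fscale (\<lambda>p. f p * vderiv A Y f p) Z + fscale (\<lambda>p. f p * f p) (D Y Z)))"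
    unfolding inner
    by (intro affine_connection_fscale_left[OF D] f0 le[OF X] Ck_vfield_add[OF A]
        Ck_vfield_fscale[OF A fYf le[OF Z]] Ck_vfield_fscale[OF A ff le[OF DYZ]])
  also have "D X (fscale (\<lambda>p. f p * vderiv A Y f p) Z + fscale (\<lambda>p. f p * f p) (D Y Z))
      = (fscale (vderiv A X (\<lambda>p. f p * vderiv A Y f p)) Z + fscale (\<lambda>p. f p * vderiv A Y f p) (D X Z))
      + (fscale (vderiv A X (\<lambda>p. f p * f p)) (D Y Z) + fscale (\<lambda>p. f p * f p) (D X (D Y Z)))"
    by (simp only: affine_connection_add_right[OF D le[OF X]
          Ck_vfield_fscale[OF A fYf le[OF Z]] Ck_vfield_fscale[OF A ff le[OF DYZ]]]
        affine_connection_fscale_right[OF D fYf le[OF X] le[OF Z]]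
        affine_connection_fscale_right[OF D ff le[OF X] le[OF DYZ]])
  finally have expansion: "D (fscale f X) (D (fscale f Y) (fscale f Z)) = fscale f
      ((fscale (vderiv A X (\<lambda>p. f p * vderiv A Y f p)) Z + fscale (\<lambda>p. f p * vderiv A Y f p) (D X Z))
      + (fscale (vderiv A X (\<lambda>p. f p * f p)) (D Y Z) + fscale (\<lambda>p. f p * f p) (D X (D Y Z))))" .
  show ?thesis
    unfolding expansion
    by (simp add: fscale_apply vderiv_mult[OF A f1 Yf] vderiv_mult[OF A f1 f1]
        power2_eq_square power3_eq_cube algebra_simps flip: scaleR_2)
qed

text \<open>Expand the bracket and use linearity of \<open>D\<close> in its first argument. When the bracket acts on the
  factor \<open>f\<close> of \<open>f Z\<close>, the terms \<open>f (X f) (Y f)\<close> and \<open>- f (Y f) (X f)\<close> cancel, and \<open>[X, Y] f\<close> is a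
  commutator of derivations.\<close>

lemma connection_lie_bracket_fscale:
  assumes A: "smooth_atlas A" and D: "affine_connection A D" and tf: "torsion_free A D"
    and f: "Ck_fun A 2 f"
    and X: "Ck_vfield A \<infinity> X" and Y: "Ck_vfield A \<infinity> Y" and Z: "Ck_vfield A \<infinity> Z"
  shows "D (lie_bracket A (fscale f X) (fscale f Y)) (fscale f Z) p c
    = ((f p)\<^sup>2 * (vderiv A X (vderiv A Y f) p - vderiv A Y (vderiv A X f) p)) *\<^sub>R Z p c
      + ((f p)\<^sup>2 * vderiv A X f p) *\<^sub>R D Y Z p c
      - ((f p)\<^sup>2 * vderiv A Y f p) *\<^sub>R D X Z p c
      + (f p ^ 3) *\<^sub>R D (lie_bracket A X Y) Z p c"
proof -
  let ?B = "lie_bracket A X Y"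
  let ?W = "lie_bracket A (fscale f X) (fscale f Y)"
  note le = Ck_vfield_of_smooth
  have f1: "Ck_fun A 1 f" and f0: "Ck_fun A 0 f" using f by (auto intro: Ck_fun_mono)
  have B: "Ck_vfield A \<infinity> ?B" by (rule Ck_vfield_lie_bracket[OF A D tf X Y])
  have Vf: "Ck_fun A 0 (vderiv A V f)" if "Ck_vfield A \<infinity> V" for V
    using f1 by (intro Ck_fun_vderiv[OF A] le[OF that]) simp
  have ff: "Ck_fun A 0 (\<lambda>p. f p * f p)" and fXf: "Ck_fun A 0 (\<lambda>p. f p * vderiv A X f p)"
    and fYf: "Ck_fun A 0 (\<lambda>p. - (f p * vderiv A Y f p))"
    by (intro Ck_fun_mult[OF A] Ck_fun_uminus[OF A] f0 Vf X Y)+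
  have W: "?W = fscale (\<lambda>p. f p * f p) ?B + fscale (\<lambda>p. f p * vderiv A X f p) Y
      + fscale (\<lambda>p. - (f p * vderiv A Y f p)) X"
    by (rule lie_bracket_fscale[OF A f1 le[OF X] le[OF Y]])
  note smooth = Ck_vfield_fscale[OF A ff le[OF B]] Ck_vfield_fscale[OF A fXf le[OF Y]]
    Ck_vfield_fscale[OF A fYf le[OF X]]
  have W0: "Ck_vfield A 0 ?W" unfolding W by (intro Ck_vfield_add[OF A] smooth)
  have DW: "D ?W Z = fscale (\<lambda>p. f p * f p) (D ?B Z) + fscale (\<lambda>p. f p * vderiv A X f p) (D Y Z)
      + fscale (\<lambda>p. - (f p * vderiv A Y f p)) (D X Z)"
    unfolding W
    by (simp only: affine_connection_add_left[OF D Ck_vfield_add[OF A smooth(1,2)] smooth(3) le[OF Z]]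
        affine_connection_add_left[OF D smooth(1,2) le[OF Z]]
        affine_connection_fscale_left[OF D ff le[OF B] le[OF Z]]
        affine_connection_fscale_left[OF D fXf le[OF Y] le[OF Z]]
        affine_connection_fscale_left[OF D fYf le[OF X] le[OF Z]])
  have Bp: "?B p \<in> tangent_space A p" using B by (simp add: Ck_vfield_def)
  have Wf: "vderiv A ?W f p = (f p)\<^sup>2 * (vderiv A X (vderiv A Y f) p - vderiv A Y (vderiv A X f) p)"
    unfolding W
    by (simp add: vderiv_add[OF A f1] vderiv_fscale[OF A f1]
        vderiv_lie_bracket[OF A f le[OF X] le[OF Y] Bp] power2_eq_square)
  have "D ?W (fscale f Z) = fscale (vderiv A ?W f) Z + fscale f (D ?W Z)"
    by (rule affine_connection_fscale_right[OF D f1 W0 le[OF Z]])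
  then show ?thesis
    by (simp add: fscale_apply Wf DW power2_eq_square power3_eq_cube algebra_simps)
qed

text \<open>Antisymmetrising the iterated derivative in \<open>X\<close> and \<open>Y\<close> removes the symmetric term
  \<open>f (X f) (Y f) Z\<close>. The remaining terms in \<open>Z\<close>, \<open>D\<^sub>X Z\<close> and \<open>D\<^sub>Y Z\<close> are exactly those of the bracket
  term, so only \<open>f\<^sup>3 R(X,Y)Z\<close> is left.\<close>

lemma stochastic_curvature_eq:
  assumes A: "smooth_atlas A" and D: "affine_connection A D" and tf: "torsion_free A D"
    and f: "Ck_fun A 2 f"
    and X: "Ck_vfield A \<infinity> X" and Y: "Ck_vfield A \<infinity> Y" and Z: "Ck_vfield A \<infinity> Z"
  shows "stochastic_curvature A D f X Y Z = fscale (\<lambda>p. f p ^ 3) (curvature A D X Y Z)"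
proof (intro ext)
  fix p c
  have double: "(2 * (f p)\<^sup>2 * a) *\<^sub>R w = ((f p)\<^sup>2 * a) *\<^sub>R w + ((f p)\<^sup>2 * a) *\<^sub>R w"
    for a and w :: 'b
    by (simp flip: scaleR_add_left)
  show "stochastic_curvature A D f X Y Z p c = fscale (\<lambda>p. f p ^ 3) (curvature A D X Y Z) p c"
    unfolding stochastic_curvature_def Let_def curvature_def fscale_apply fun_diff_def
      iterated_connection_fscale[OF A D f X Y Z] iterated_connection_fscale[OF A D f Y X Z]
      connection_lie_bracket_fscale[OF A D tf f X Y Z] double
    by (simp add: power2_eq_square algebra_simps)
qed

text \<open>The identity is deterministic: one null set, outside which the realisation is of class \<open>C\<^sup>2\<close>,
  serves for all vector fields at once.\<close>

theorem lemma2: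
  fixes A :: "('m::{t2_space,second_countable_topology}, 'b::euclidean_space) chart set"
    and g :: "'m \<Rightarrow> ('m, 'b) tvec \<Rightarrow> ('m, 'b) tvec \<Rightarrow> real"
    and D :: "('m, 'b) vfield \<Rightarrow> ('m, 'b) vfield \<Rightarrow> ('m, 'b) vfield"
    and P :: "'w measure"
    and \<epsilon> :: "'w \<Rightarrow> 'm \<Rightarrow> real"
  assumes "riemannian_manifold A g"
    and "levi_civita A g D"
    and "prob_space P"
    and "\<And>p. (\<lambda>\<omega>. \<epsilon> \<omega> p) \<in> borel_measurable P"
    and "AE \<omega> in P. Ck_fun A 2 (\<epsilon> \<omega>)"
  shows "AE \<omega> in P. \<forall>X Y Z.
    Ck_vfield A \<infinity> X \<longrightarrow> Ck_vfield A \<infinity> Y \<longrightarrow> Ck_vfield A \<infinity> Z \<longrightarrow>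
    stochastic_curvature A D (\<epsilon> \<omega>) X Y Z = fscale (\<lambda>p. \<epsilon> \<omega> p ^ 3) (curvature A D X Y Z)"
  using assms(5)
proof (rule eventually_mono)
  fix \<omega> assume "Ck_fun A 2 (\<epsilon> \<omega>)"
  moreover have "smooth_atlas A" "affine_connection A D" "torsion_free A D"
    using assms(1,2) by (simp_all add: riemannian_manifold_def levi_civita_def)
  ultimately show "\<forall>X Y Z. Ck_vfield A \<infinity> X \<longrightarrow> Ck_vfield A \<infinity> Y \<longrightarrow> Ck_vfield A \<infinity> Z \<longrightarrow>
    stochastic_curvature A D (\<epsilon> \<omega>) X Y Z = fscale (\<lambda>p. \<epsilon> \<omega> p ^ 3) (curvature A D X Y Z)"
    by (blast intro: stochastic_curvature_eq)
qed

end
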